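(* Let $N\ge 1$ and $s\ge 1$. There exists an $s$-strike set $A$ which can be partitioned as $A=A_s\cup A_{s-1}\cup\cdots\cup A_1$, where for each $1\le i\le s$ the set $A_i$ is $1$-minimal and consists of type $i$-positive permutations, such that the maximum probability of winning equals $\bigoplus_{\sigma\in A_s}Q_s(\sigma)$. Furthermore, this probability of winning equals $$\frac{\sum_{\sigma\in A}Q_1(\sigma)\cdot SD(\sigma)}{N!}.$$
   Context: Setting: $N$ applicants labeled $1,\dots,N$ by quality ($N$ best); the interview order is a uniformly random $\pi\in S_N$ revealed from the left, only relative orders of seen entries observed; $s$ selections, each applicant irrevocably accepted (using a selection) or rejected; win if a selected applicant has value $N$; the maximum probability of winning is over all strategies. For $\pi$ of length $\ge k$, $\pi|_k\in S_k$ is the relabelling of its first $k$ entries by relative order; $\tau$ has $\sigma\in S_k$ as prefix if $\tau|_k=\sigma$; $\pi\in S_N$ is then $\sigma$-prefixed. $SD(\sigma)$ = number of $\sigma$-prefixed $\pi\in S_N$; $Win(\sigma)$ = number of those with $\pi(k)=N$. A position of a permutation is a left-to-right maximum if its value exceeds all values to its left; a permutation of length $\le N$ is eligible if its last position is a left-to-right maximum or it has length $N$. For $\sigma$ of length $k$, $1\le i\le s$: $Q_1(\sigma)=Win(\sigma)/SD(\sigma)$; $Q_i(\sigma)$ = probability of winning by accepting applicant $k$ and playing optimally thereafter, conditioned on $\pi$ $\sigma$-prefixed and $i$ selections available when interviewing applicant $k$; $Q^o_i(\sigma)$ = probability of winning with the best strategy after deciding on applicant $k$, conditioned on $\pi$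 $\sigma$-prefixed and $i$ selections still available right after interviewing applicant $k$. $\sigma$ is type $i$-positive if $Q_i(\sigma)\ge Q^o_i(\sigma)$. A set $X$ of permutations is $m$-minimal if there are no $\alpha_1,\dots,\alpha_{m+1}\in X$ with $\alpha_{j+1}$ a proper prefix of $\alpha_j$ for all $j\le m$. An $s$-strike set is a set $A\subseteq\bigcup_{j=1}^N S_j$ such that (i) all elements of $A$ are eligible; (ii) $A$ is $s$-minimal; (iii) every permutation in $S_N$ has some element of $A$ as a prefix. Probabilities are written as unreduced fractions with denominator $SD$, and $\frac ab\oplus\frac cd=\frac{a+c}{b+d}$. *)

theory Defs
  imports "HOL-Probability.Probability" "HOL-Combinatorics.Multiset_Permutations"
begin

text \<open>Permutations are lists in one-line notation; positions are counted from 1.\<close>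

definition Perms :: "nat \<Rightarrow> nat list set" where
  "Perms k = permutations_of_set {1..k}"

definition entry :: "nat list \<Rightarrow> nat \<Rightarrow> nat" where
  "entry \<pi> p = \<pi> ! (p - 1)"

definition relabel :: "nat list \<Rightarrow> nat list" where
  "relabel xs = map (\<lambda>x. card {y \<in> set xs. y \<le> x}) xs"

definition restr :: "nat list \<Rightarrow> nat \<Rightarrow> nat list" where
  "restr \<pi> k = relabel (take k \<pi>)"

definition prefix_of :: "nat list \<Rightarrow> nat list \<Rightarrow> bool" where
  "prefix_of \<sigma> \<tau> \<longleftrightarrow> length \<sigma> \<le> length \<tau> \<and> restr \<tau> (length \<sigma>) = \<sigma>"

definition proper_prefix_of :: "nat list \<Rightarrow> nat list \<Rightarrow> bool" where
  "proper_prefix_of \<sigma> \<tau> \<longleftrightarrow> prefix_of \<sigma> \<tau> \<and> \<sigma> \<noteq> \<tau>"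

definition SD :: "nat \<Rightarrow> nat list \<Rightarrow> nat" where
  "SD N \<sigma> = card {\<pi> \<in> Perms N. prefix_of \<sigma> \<pi>}"

definition Win :: "nat \<Rightarrow> nat list \<Rightarrow> nat" where
  "Win N \<sigma> = card {\<pi> \<in> Perms N. prefix_of \<sigma> \<pi> \<and> entry \<pi> (length \<sigma>) = N}"

definition lr_max :: "nat list \<Rightarrow> nat \<Rightarrow> bool" where
  "lr_max \<pi> p \<longleftrightarrow> p \<in> {1..length \<pi>} \<and> (\<forall>q\<in>{1..<p}. entry \<pi> q < entry \<pi> p)"

definition eligible :: "nat \<Rightarrow> nat list \<Rightarrow> bool" where
  "eligible N \<sigma> \<longleftrightarrow> length \<sigma> \<le> N \<and> (lr_max \<sigma> (length \<sigma>) \<or> length \<sigma> = N)"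

text \<open>
  A strategy decides on the current applicant (\<^term>\<open>True\<close> meaning acceptance) from the relative
  order of all applicants seen so far, including the current one, and the number of selections
  still available. Its own earlier decisions are determined by the earlier relative orders, so
  they need not be a further argument.
\<close>

type_synonym strategy = "nat list \<Rightarrow> nat \<Rightarrow> bool"

text \<open>
  \<open>sels_left d k i \<pi> p\<close> is the number of selections left right after applicant \<open>p\<close> when \<open>i\<close> of
  them are left right after applicant \<open>k\<close> and \<open>d\<close> is followed from applicant \<open>k + 1\<close> on. The case
  \<open>k = 0\<close> is the whole game.
\<close>

primrec sels_left :: "strategy \<Rightarrow> nat \<Rightarrow> nat \<Rightarrow> nat list \<Rightarrow> nat \<Rightarrow> nat" where
  "sels_left d k i \<pi> 0 = i"
| "sels_left d k i \<pi> (Suc p) =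
     (let r = sels_left d k i \<pi> p
      in if k < Suc p \<and> r > 0 \<and> d (restr \<pi> (Suc p)) r then r - 1 else r)"

definition accepts :: "strategy \<Rightarrow> nat \<Rightarrow> nat \<Rightarrow> nat list \<Rightarrow> nat \<Rightarrow> bool" where
  "accepts d k i \<pi> p \<longleftrightarrow>
     p \<in> {k<..length \<pi>} \<and> sels_left d k i \<pi> (p - 1) > 0 \<and>
     d (restr \<pi> p) (sels_left d k i \<pi> (p - 1))"

definition wins :: "strategy \<Rightarrow> nat \<Rightarrow> nat \<Rightarrow> nat list \<Rightarrow> bool" where
  "wins d k i \<pi> \<longleftrightarrow> (\<exists>p. accepts d k i \<pi> p \<and> entry \<pi> p = length \<pi>)"

definition interview_order :: "nat \<Rightarrow> nat list measure" where
  "interview_order N = measure_pmf (pmf_of_set (Perms N))"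

definition max_win_prob :: "nat \<Rightarrow> nat \<Rightarrow> real" where
  "max_win_prob N s = Max (range (\<lambda>d. \<P>(\<pi> in interview_order N. wins d 0 s \<pi>)))"

definition Q :: "nat \<Rightarrow> nat \<Rightarrow> nat list \<Rightarrow> real" where
  "Q N i \<sigma> =
     (if i = 1 then real (Win N \<sigma>) / real (SD N \<sigma>)
      else Max (range (\<lambda>d. \<P>(\<pi> in interview_order N.
             entry \<pi> (length \<sigma>) = N \<or> wins d (length \<sigma>) (i - 1) \<pi> \<bar> prefix_of \<sigma> \<pi>))))"

definition Qo :: "nat \<Rightarrow> nat \<Rightarrow> nat list \<Rightarrow> real" where
  "Qo N i \<sigma> =
     Max (range (\<lambda>d. \<P>(\<pi> in interview_order N. wins d (length \<sigma>) i \<pi> \<bar> prefix_of \<sigma> \<pi>)))"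

definition type_positive :: "nat \<Rightarrow> nat \<Rightarrow> nat list \<Rightarrow> bool" where
  "type_positive N i \<sigma> \<longleftrightarrow> Q N i \<sigma> \<ge> Qo N i \<sigma>"

definition minimal :: "nat \<Rightarrow> nat list set \<Rightarrow> bool" where
  "minimal m X \<longleftrightarrow>
     \<not> (\<exists>\<alpha> :: nat \<Rightarrow> nat list. (\<forall>j\<in>{1..m + 1}. \<alpha> j \<in> X) \<and>
          (\<forall>j\<in>{1..m}. proper_prefix_of (\<alpha> (j + 1)) (\<alpha> j)))"

definition strike_set :: "nat \<Rightarrow> nat \<Rightarrow> nat list set \<Rightarrow> bool" where
  "strike_set N s A \<longleftrightarrow>
     A \<subseteq> (\<Union>j\<in>{1..N}. Perms j) \<and>
     (\<forall>\<sigma>\<in>A. eligible N \<sigma>) \<and>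
     minimal s A \<and>
     (\<forall>\<pi>\<in>Perms N. \<exists>\<sigma>\<in>A. prefix_of \<sigma> \<pi>)"

text \<open>
  An unreduced fraction is the pair of its numerator and denominator. The operation
  \<open>a/b \<oplus> c/d = (a + c)/(b + d)\<close> is then the componentwise addition of pairs, and an iterated
  \<open>\<oplus>\<close> is a sum of pairs.
\<close>

definition unreduced :: "nat \<Rightarrow> nat list \<Rightarrow> real \<Rightarrow> real \<times> real" where
  "unreduced N \<sigma> p = (p * real (SD N \<sigma>), real (SD N \<sigma>))"

definition frac_value :: "real \<times> real \<Rightarrow> real" where
  "frac_value x = fst x / snd x"

end

theory Submission
  imports Defs
begin

text \<open>
  Call \<open>greedy\<close> the strategy that, with \<open>i\<close> selections left, accepts exactly at the eligible type
  \<open>i\<close>-positive prefixes. Splitting over the children of a prefix in the prefix tree, downward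
  induction on its length shows that this strategy is optimal from every prefix: at a prefix that is
  not eligible, accepting the current applicant cannot win now and only loses a selection.

  Let \<open>A\<close> be the set of prefixes at which this strategy makes a selection, and \<open>A\<^sub>i\<close> the set of those
  at which it has \<open>i\<close> selections left. The number of selections left drops after each selection, so
  along a chain of prefixes in \<open>A\<close> it is strictly monotone, which gives all minimality claims. Each
  \<open>\<pi>\<close> has exactly one prefix in \<open>A\<^sub>s\<close>, its first selection, since a full permutation is always
  positive. Counting the winning \<open>\<pi>\<close> by their first selection gives the first formula; counting them
  by the selection that wins gives the second.
\<close>

section \<open>Relative orders\<close>

text \<open>A map strictly increasing on the entries carries the entries up to \<open>x\<close>
  bijectively onto those up to \<open>f x\<close>, so ranks do not change.\<close>

lemma relabel_map:
  assumes "strict_mono_on (set xs) f"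
  shows "relabel (map f xs) = relabel xs"
proof -
  have "card {y \<in> f ` set xs. y \<le> f x} = card {y \<in> set xs. y \<le> x}" if "x \<in> set xs" for x
  proof -
    have "{y \<in> f ` set xs. y \<le> f x} = f ` {y \<in> set xs. y \<le> x}"
      using assms that by (auto simp: strict_mono_on_leD dest: strict_mono_on_less_eq)
    moreover have "inj_on f {y \<in> set xs. y \<le> x}"
      using strict_mono_on_imp_inj_on[OF assms] by (rule inj_on_subset) auto
    ultimately show ?thesis
      by (simp add: card_image)
  qed
  then show ?thesis
    by (simp add: relabel_def)
qed

lemma strict_mono_on_rank:
  fixes S :: "nat set"
  assumes "finite S"
  shows "strict_mono_on S (\<lambda>x. card {y \<in> S. y \<le> x})"
proof (rule strict_mono_onI)
  fix a b assume "a \<in> S" "b \<in> S" "a < b"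
  then have "{y \<in> S. y \<le> a} \<subseteq> {y \<in> S. y \<le> b}" "b \<in> {y \<in> S. y \<le> b} - {y \<in> S. y \<le> a}"
    by auto
  then have "{y \<in> S. y \<le> a} \<subset> {y \<in> S. y \<le> b}"
    by blast
  then show "card {y \<in> S. y \<le> a} < card {y \<in> S. y \<le> b}"
    using assms by (intro psubset_card_mono) auto
qed

lemma restr_eq_map:
  obtains f where "restr \<pi> k = map f (take k \<pi>)" "strict_mono_on (set (take k \<pi>)) f"
  using strict_mono_on_rank[of "set (take k \<pi>)"] by (force simp: restr_def relabel_def)

lemma length_restr [simp]: "length (restr \<pi> k) = min (length \<pi>) k"
  by (simp add: restr_def relabel_def)

text \<open>Replacing entries by their ranks is itself strictly increasing, so it does not affect
  the ranks computed afterwards in a shorter prefix. This consistency makes the prefix relation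
  transitive.\<close>

lemma restr_restr:
  assumes "j \<le> k"
  shows "restr (restr \<pi> k) j = restr \<pi> j"
proof -
  obtain f where f: "restr \<pi> k = map f (take k \<pi>)" "strict_mono_on (set (take k \<pi>)) f"
    by (rule restr_eq_map)
  have "take j \<pi> = take j (take k \<pi>)"
    using assms by (simp add: min_absorb1)
  then have "set (take j \<pi>) \<subseteq> set (take k \<pi>)"
    by (metis set_take_subset)
  then have "strict_mono_on (set (take j \<pi>)) f"
    using f(2) by (auto simp: strict_mono_on_def)
  then show ?thesis
    using assms by (simp add: restr_def[of _ j] f(1) take_map relabel_map min_absorb1)
qed

text \<open>The ranks are \<open>k\<close> distinct values in \<open>{1..k}\<close> and therefore
  exhaust it.\<close>

lemma restr_in_Perms:
  assumes "distinct \<pi>" "k \<le> length \<pi>"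
  shows "restr \<pi> k \<in> Perms k"
proof -
  obtain f where f: "restr \<pi> k = map f (take k \<pi>)" "strict_mono_on (set (take k \<pi>)) f"
    by (rule restr_eq_map)
  have dist: "distinct (restr \<pi> k)"
    using assms f by (simp add: distinct_map strict_mono_on_imp_inj_on)
  have card: "card (set (take k \<pi>)) = k"
    using assms by (simp add: distinct_card)
  have "set (restr \<pi> k) \<subseteq> {1..k}"
  proof
    fix z assume "z \<in> set (restr \<pi> k)"
    then obtain x where x: "x \<in> set (take k \<pi>)" and z: "z = card {y \<in> set (take k \<pi>). y \<le> x}"
      by (auto simp: restr_def relabel_def)
    from x have "z > 0"
      unfolding z by (subst card_gt_0_iff) auto
    moreover have "z \<le> card (set (take k \<pi>))"
      unfolding z by (intro card_mono) auto
    ultimately show "z \<in> {1..k}"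
      by (simp add: card)
  qed
  moreover have "card (set (restr \<pi> k)) = card {1..k}"
    using assms distinct_card[OF dist] by simp
  ultimately have "set (restr \<pi> k) = {1..k}"
    by (intro card_subset_eq) auto
  with dist show ?thesis
    by (simp add: Perms_def permutations_of_set_def)
qed

lemma Perms_distinct: "\<pi> \<in> Perms N \<Longrightarrow> distinct \<pi>"
  and Perms_set: "\<pi> \<in> Perms N \<Longrightarrow> set \<pi> = {1..N}"
  by (auto simp: Perms_def permutations_of_set_def)

lemma Perms_length: "\<pi> \<in> Perms N \<Longrightarrow> length \<pi> = N"
  using distinct_card[of \<pi>] by (simp add: Perms_distinct Perms_set)

lemma finite_Perms [simp]: "finite (Perms N)"
  and card_Perms [simp]: "card (Perms N) = fact N"
  by (simp_all add: Perms_def)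

lemma Perms_nonempty [simp]: "Perms N \<noteq> {}"
  using card_Perms[of N] by (metis card.empty fact_nonzero)

lemma restr_Perms_self:
  assumes "\<pi> \<in> Perms N"
  shows "restr \<pi> N = \<pi>"
proof -
  have rank: "card {y \<in> {1..N}. y \<le> x} = x" if "x \<in> {1..N}" for x
  proof -
    have "{y \<in> {1..N}. y \<le> x} = {1..x}"
      using that by auto
    then show ?thesis by simp
  qed
  have "take N \<pi> = \<pi>"
    using assms by (simp add: Perms_length)
  then have "restr \<pi> N = map (\<lambda>x. card {y \<in> {1..N}. y \<le> x}) \<pi>"
    unfolding restr_def relabel_def Perms_set[OF assms, symmetric] by simp
  also have "\<dots> = \<pi>"
    by (rule map_idI) (simp only: rank Perms_set[OF assms])
  finally show ?thesis .
qed

lemma entry_inject_Perms: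
  assumes "\<pi> \<in> Perms N" "p \<in> {1..N}" "q \<in> {1..N}" "entry \<pi> p = entry \<pi> q"
  shows "p = q"
  using assms Perms_distinct[OF assms(1)] Perms_length[OF assms(1)]
  by (auto simp: entry_def nth_eq_iff_index_eq)

text \<open>The value \<open>N\<close> exceeds every earlier entry, and passing to ranks preserves
  strict inequalities. Contrapositively, accepting at a prefix that is not eligible never wins on
  the spot.\<close>

lemma lr_max_restr_maximum:
  assumes \<pi>: "\<pi> \<in> Perms N" and k: "k \<in> {1..N}" and max: "entry \<pi> k = N"
  shows "lr_max (restr \<pi> k) k"
proof -
  obtain f where f: "restr \<pi> k = map f (take k \<pi>)" "strict_mono_on (set (take k \<pi>)) f"
    by (rule restr_eq_map)
  have len: "length \<pi> = N"
    using \<pi> by (rule Perms_length)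
  have "entry (restr \<pi> k) q < entry (restr \<pi> k) k" if q: "q \<in> {1..<k}" for q
  proof -
    have in_take: "entry \<pi> p \<in> set (take k \<pi>)" "entry (restr \<pi> k) p = f (entry \<pi> p)"
      if "p \<in> {1..k}" for p
    proof -
      have "p - 1 < length (take k \<pi>)" "p - 1 < k"
        using that k len by auto
      moreover from this have "take k \<pi> ! (p - 1) = entry \<pi> p"
        by (simp add: entry_def)
      ultimately show "entry \<pi> p \<in> set (take k \<pi>)" "entry (restr \<pi> k) p = f (entry \<pi> p)"
        by (metis nth_mem, simp add: f(1) entry_def)
    qed
    have "entry \<pi> q \<in> {1..N}"
      using in_take(1)[of q] q Perms_set[OF \<pi>] set_take_subset[of k \<pi>] by fastforce
    moreover have "entry \<pi> q \<noteq> N"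
      using entry_inject_Perms[OF \<pi>, of q k] q k max by auto
    ultimately have "entry \<pi> q < entry \<pi> k"
      using max by simp
    then have "f (entry \<pi> q) < f (entry \<pi> k)"
      using q in_take[of q] in_take[of k] by (intro strict_mono_onD[OF f(2)]) auto
    then show ?thesis
      using q in_take[of q] in_take[of k] by simp
  qed
  then show ?thesis
    using k len by (simp add: lr_max_def)
qed

section \<open>The prefix relation\<close>

lemma prefix_of_restr: "k \<le> length \<pi> \<Longrightarrow> prefix_of (restr \<pi> k) \<pi>"
  by (simp add: prefix_of_def min_absorb2)

lemma prefix_of_trans: "prefix_of \<rho> \<sigma> \<Longrightarrow> prefix_of \<sigma> \<tau> \<Longrightarrow> prefix_of \<rho> \<tau>"
  unfolding prefix_of_def by (metis le_trans restr_restr)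

text \<open>A prefix of a restriction of \<open>\<pi>\<close> is the restriction of
  \<open>\<pi>\<close> to its own length, so equal lengths would force equality.\<close>

lemma proper_prefix_of_restr:
  assumes "proper_prefix_of \<sigma> (restr \<pi> k)" "k \<le> length \<pi>"
  shows "length \<sigma> < k"
proof -
  have *: "length \<sigma> \<le> k" "restr (restr \<pi> k) (length \<sigma>) = \<sigma>" "\<sigma> \<noteq> restr \<pi> k"
    using assms by (auto simp: proper_prefix_of_def prefix_of_def)
  then show ?thesis
    by (metis restr_restr le_neq_implies_less)
qed

section \<open>Runs of a strategy\<close>

lemma sels_left_start: "p \<le> k \<Longrightarrow> sels_left d k i \<pi> p = i"
  by (induction p) (auto simp: Let_def)

lemma sels_left_antimono: "p \<le> q \<Longrightarrow> sels_left d k i \<pi> q \<le> sels_left d k i \<pi> p"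
  by (induction q rule: dec_induct) (auto simp: Let_def)

text \<open>A Markov property: the past affects the further run only through the number of
  selections left.\<close>

lemma sels_left_restart:
  "m \<le> p \<Longrightarrow> k \<le> m \<Longrightarrow> sels_left d m (sels_left d k i \<pi> m) \<pi> p = sels_left d k i \<pi> p"
proof (induction p rule: dec_induct)
  case base
  then show ?case by (simp add: sels_left_start)
next
  case (step p)
  then show ?case by (auto simp: Let_def)
qed

text \<open>The decisions up to position \<open>p\<close> read only relative orders of the first
  \<open>p\<close> entries, so the number of selections left is a function of the prefix.\<close>

lemma sels_left_restr:
  "p \<le> m \<Longrightarrow> sels_left d k i (restr \<pi> m) p = sels_left d k i \<pi> p"
  by (induction p) (auto simp: Let_def restr_restr)

lemma sels_left_accepts:
  assumes "accepts d k i \<pi> p"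
  shows "Suc (sels_left d k i \<pi> p) = sels_left d k i \<pi> (p - 1)"
  using assms by (cases p) (auto simp: accepts_def Let_def)

lemma accepts_restart:
  assumes "m < p" "k \<le> m"
  shows "accepts d m (sels_left d k i \<pi> m) \<pi> p \<longleftrightarrow> accepts d k i \<pi> p"
  using assms by (auto simp: accepts_def sels_left_restart)

lemma wins_split:
  assumes "k \<le> m"
  shows "wins d k i \<pi> \<longleftrightarrow>
    (\<exists>p\<in>{k<..m}. accepts d k i \<pi> p \<and> entry \<pi> p = length \<pi>) \<or>
    wins d m (sels_left d k i \<pi> m) \<pi>"
proof -
  have "accepts d k i \<pi> p \<Longrightarrow> p > k" "accepts d m j \<pi> p \<Longrightarrow> p > m" for p j
    by (auto simp: accepts_def)
  then show ?thesis
    unfolding wins_def using accepts_restart[OF _ assms] assms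
    by (metis greaterThanAtMost_iff not_le_imp_less)
qed

lemma wins_step:
  assumes "k < length \<pi>"
  shows "wins d k i \<pi> \<longleftrightarrow>
    (if i > 0 \<and> d (restr \<pi> (Suc k)) i
     then entry \<pi> (Suc k) = length \<pi> \<or> wins d (Suc k) (i - 1) \<pi>
     else wins d (Suc k) i \<pi>)"
proof -
  have "{k<..Suc k} = {Suc k}" by auto
  moreover have "accepts d k i \<pi> (Suc k) \<longleftrightarrow> i > 0 \<and> d (restr \<pi> (Suc k)) i"
    using assms by (auto simp: accepts_def sels_left_start)
  moreover have "sels_left d k i \<pi> (Suc k) = (if i > 0 \<and> d (restr \<pi> (Suc k)) i then i - 1 else i)"
    by (simp add: sels_left_start)
  ultimately show ?thesis
    using wins_split[of k "Suc k" d i \<pi>] by auto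
qed

text \<open>The modified strategy holds one selection back for good: with \<open>r\<close>
  selections it asks \<open>d\<close> what to do with \<open>r - 1\<close>, and it never spends the
  last one. It thus imitates \<open>d\<close> while always having one more left.\<close>

lemma sels_left_spare:
  "sels_left (\<lambda>\<tau> r. d \<tau> (r - Suc 0) \<and> r > Suc 0) k (Suc i) \<pi> p = Suc (sels_left d k i \<pi> p)"
  by (induction p) (auto simp: Let_def)

lemma wins_spare:
  assumes "wins d k i \<pi>"
  shows "wins (\<lambda>\<tau> r. d \<tau> (r - Suc 0) \<and> r > Suc 0) k (Suc i) \<pi>"
proof -
  obtain p where "accepts d k i \<pi> p" "entry \<pi> p = length \<pi>"
    using assms by (auto simp: wins_def)
  then show ?thesis
    unfolding wins_def by (intro exI[of _ p]) (simp add: accepts_def sels_left_spare)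
qed

lemma not_wins_no_selections: "\<not> wins d k 0 \<pi>"
proof -
  have "sels_left d k 0 \<pi> p = 0" for p
    using sels_left_antimono[of 0 p d k 0 \<pi>] by simp
  then show ?thesis
    by (simp add: wins_def accepts_def)
qed

lemma not_wins_at_end: "length \<pi> \<le> k \<Longrightarrow> \<not> wins d k i \<pi>"
  by (auto simp: wins_def accepts_def)

section \<open>The prefixes at which a strategy selects\<close>

text \<open>The position is \<open>length \<sigma> - 1\<close> because the selections are counted
  just before the decision on the last applicant of \<open>\<sigma>\<close>.\<close>

definition selection_index :: "strategy \<Rightarrow> nat \<Rightarrow> nat list \<Rightarrow> nat" where
  "selection_index d s \<sigma> = sels_left d 0 s \<sigma> (length \<sigma> - 1)"

text \<open>Built from full permutations, so that each element has an extension in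
  \<open>Perms N\<close>, and hence a nonzero \<open>SD\<close>.\<close>

definition selected :: "nat \<Rightarrow> strategy \<Rightarrow> nat \<Rightarrow> nat list set" where
  "selected N d s = {restr \<pi> p | \<pi> p. \<pi> \<in> Perms N \<and> accepts d 0 s \<pi> p}"

lemma selectedE:
  assumes "\<sigma> \<in> selected N d s"
  obtains \<pi> where "\<pi> \<in> Perms N" "prefix_of \<sigma> \<pi>" "accepts d 0 s \<pi> (length \<sigma>)"
    "length \<sigma> \<in> {1..N}"
proof -
  obtain \<pi> p where *: "\<sigma> = restr \<pi> p" "\<pi> \<in> Perms N" "accepts d 0 s \<pi> p"
    using assms by (auto simp: selected_def)
  then have "p \<in> {1..N}"
    by (auto simp: accepts_def Perms_length)
  then show thesis
    using that[of \<pi>] * by (auto simp: Perms_length prefix_of_restr min_absorb2)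
qed

lemma sels_left_eq_selection_index:
  assumes "prefix_of \<sigma> \<pi>"
  shows "sels_left d 0 s \<pi> (length \<sigma> - 1) = selection_index d s \<sigma>"
  using assms sels_left_restr[of "length \<sigma> - 1" "length \<sigma>" d 0 s \<pi>]
  unfolding selection_index_def prefix_of_def by simp

text \<open>The right-hand side does not mention \<open>\<pi>\<close>: all
  \<open>\<sigma>\<close>-prefixed permutations agree on whether the last applicant of
  \<open>\<sigma>\<close> is accepted.\<close>

lemma accepts_prefix_iff:
  assumes "\<pi> \<in> Perms N" "prefix_of \<sigma> \<pi>"
  shows "accepts d 0 s \<pi> (length \<sigma>) \<longleftrightarrow>
    length \<sigma> \<in> {1..N} \<and> selection_index d s \<sigma> > 0 \<and> d \<sigma> (selection_index d s \<sigma>)"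
  using assms unfolding accepts_def sels_left_eq_selection_index[OF assms(2)]
  by (auto simp: prefix_of_def Perms_length Suc_le_eq)

lemma accepts_of_selected:
  assumes "\<sigma> \<in> selected N d s" "\<pi> \<in> Perms N" "prefix_of \<sigma> \<pi>"
  shows "accepts d 0 s \<pi> (length \<sigma>)"
  using selectedE[OF assms(1)] accepts_prefix_iff assms(2,3) by metis

lemma selected_decision:
  assumes "\<sigma> \<in> selected N d s"
  shows "d \<sigma> (selection_index d s \<sigma>)" "selection_index d s \<sigma> \<in> {1..s}" "length \<sigma> \<in> {1..N}"
    "\<sigma> \<in> Perms (length \<sigma>)"
proof -
  obtain \<pi> where \<pi>: "\<pi> \<in> Perms N" "prefix_of \<sigma> \<pi>" "accepts d 0 s \<pi> (length \<sigma>)"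
    "length \<sigma> \<in> {1..N}"
    using assms by (rule selectedE)
  then show "d \<sigma> (selection_index d s \<sigma>)" "length \<sigma> \<in> {1..N}"
    using accepts_prefix_iff[OF \<pi>(1,2)] by auto
  show "selection_index d s \<sigma> \<in> {1..s}"
    using \<pi> accepts_prefix_iff[OF \<pi>(1,2)] sels_left_antimono[of 0 _ d 0 s \<sigma>]
    by (auto simp: selection_index_def Suc_le_eq)
  show "\<sigma> \<in> Perms (length \<sigma>)"
    using restr_in_Perms[of \<pi> "length \<sigma>"] \<pi>
    by (auto simp: prefix_of_def Perms_distinct)
qed

lemma finite_selected [simp]: "finite (selected N d s)"
proof (rule finite_subset)
  show "selected N d s \<subseteq> (\<Union>j\<le>N. Perms j)"
    using selected_decision(3,4) by fastforce
qed auto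

text \<open>The acceptance at the end of \<open>\<sigma>\<close> spends a selection, and the number
  left never rises again before \<open>\<tau>\<close> ends.\<close>

lemma selection_index_proper_prefix:
  assumes "\<sigma> \<in> selected N d s" "\<tau> \<in> selected N d s" "proper_prefix_of \<sigma> \<tau>"
  shows "selection_index d s \<tau> < selection_index d s \<sigma>"
proof -
  obtain \<pi> where \<pi>: "\<pi> \<in> Perms N" "prefix_of \<tau> \<pi>" "length \<tau> \<in> {1..N}"
    using assms(2) by (rule selectedE)
  have \<tau>: "\<tau> = restr \<pi> (length \<tau>)"
    using \<pi>(2) by (simp add: prefix_of_def)
  then have len: "length \<sigma> < length \<tau>"
    using proper_prefix_of_restr[of \<sigma> \<pi> "length \<tau>"] assms(3) \<pi>
    by (simp add: Perms_length)
  have \<sigma>: "prefix_of \<sigma> \<pi>"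
    using assms(3) \<pi>(2) prefix_of_trans by (auto simp: proper_prefix_of_def)
  then have "Suc (sels_left d 0 s \<pi> (length \<sigma>)) = selection_index d s \<sigma>"
    using sels_left_accepts[OF accepts_of_selected[OF assms(1) \<pi>(1)]]
    by (simp only: sels_left_eq_selection_index)
  moreover have "selection_index d s \<tau> \<le> sels_left d 0 s \<pi> (length \<sigma>)"
    using len unfolding sels_left_eq_selection_index[OF \<pi>(2), symmetric]
    by (intro sels_left_antimono) auto
  ultimately show ?thesis by simp
qed

text \<open>A forbidden chain would give \<open>s + 1\<close> strictly monotone indices inside
  \<open>{1..s}\<close>.\<close>

lemma minimal_selected: "minimal s (selected N d s)"
  unfolding minimal_def
proof (rule notI, elim exE conjE)
  fix \<alpha> :: "nat \<Rightarrow> nat list"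
  assume \<alpha>: "\<forall>j\<in>{1..s + 1}. \<alpha> j \<in> selected N d s"
    and pre: "\<forall>j\<in>{1..s}. proper_prefix_of (\<alpha> (j + 1)) (\<alpha> j)"
  \<comment> \<open>The chain runs from the longest prefix to the shortest, so the indices start at
    1 or more at \<open>\<alpha> 1\<close> and increase with \<open>j\<close>, exceeding
    \<open>s\<close> at the end.\<close>
  have "Suc j \<le> selection_index d s (\<alpha> (Suc j))" if "j \<le> s" for j
    using that
  proof (induction j)
    case 0
    then show ?case
      using selected_decision(2)[of "\<alpha> 1" N d s] \<alpha> by auto
  next
    case (Suc j)
    then have "selection_index d s (\<alpha> (Suc j)) < selection_index d s (\<alpha> (Suc (Suc j)))"
      using \<alpha> pre by (intro selection_index_proper_prefix[of _ N]) (auto simp: Ball_def)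
    with Suc show ?case by simp
  qed
  from this[of s] show False
    using selected_decision(2)[of "\<alpha> (Suc s)" N d s] \<alpha> by auto
qed

lemma minimal_selected_level:
  "minimal 1 {\<sigma> \<in> selected N d s. selection_index d s \<sigma> = i}" (is "minimal 1 ?L")
  unfolding minimal_def
proof (rule notI, elim exE conjE)
  fix \<alpha> :: "nat \<Rightarrow> nat list"
  assume \<alpha>: "\<forall>j\<in>{1..1 + 1}. \<alpha> j \<in> ?L"
    and pre: "\<forall>j\<in>{1..1}. proper_prefix_of (\<alpha> (j + 1)) (\<alpha> j)"
  have "\<alpha> 1 \<in> ?L" "\<alpha> (1 + 1) \<in> ?L"
    by (rule bspec[OF \<alpha>], simp)+
  moreover have "proper_prefix_of (\<alpha> (1 + 1)) (\<alpha> 1)"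
    by (rule bspec[OF pre]) simp
  ultimately show False
    using selection_index_proper_prefix[of "\<alpha> (1 + 1)" N d s "\<alpha> 1"] by simp
qed

section \<open>Counting wins\<close>

text \<open>Double counting, used to split permutations by child, by first selection and by winning
  selection.\<close>

lemma sum_card_unique:
  assumes "finite A" "finite X" "\<And>x. x \<in> X \<Longrightarrow> \<exists>!a. a \<in> A \<and> R a x"
  shows "(\<Sum>a\<in>A. card {x \<in> X. R a x}) = card X"
proof -
  have "card (\<Union>a\<in>A. {x \<in> X. R a x}) = (\<Sum>a\<in>A. card {x \<in> X. R a x})"
    using assms by (intro card_UN_disjoint) auto
  moreover have "(\<Union>a\<in>A. {x \<in> X. R a x}) = X"
    using assms(3) by blast
  ultimately show ?thesis by simp
qed

text \<open>The numerator of a conditional winning probability over the denominator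
  \<open>SD N \<sigma>\<close>. All strategies continuing from \<open>\<sigma>\<close> share that
  denominator, so they can be compared by natural numbers.\<close>

definition win_count :: "nat \<Rightarrow> strategy \<Rightarrow> nat \<Rightarrow> nat list \<Rightarrow> nat" where
  "win_count N d i \<sigma> = card {\<pi> \<in> Perms N. prefix_of \<sigma> \<pi> \<and> wins d (length \<sigma>) i \<pi>}"

lemma win_count_no_selections [simp]: "win_count N d 0 \<sigma> = 0"
  by (simp add: win_count_def not_wins_no_selections)

lemma win_count_spare:
  "win_count N d i \<sigma> \<le> win_count N (\<lambda>\<tau> r. d \<tau> (r - Suc 0) \<and> r > Suc 0) (Suc i) \<sigma>"
  unfolding win_count_def by (intro card_mono) (auto intro: wins_spare)

text \<open>The value \<open>N\<close> occurs at only one position, so winning at the end of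
  \<open>\<sigma>\<close> and winning later are disjoint events.\<close>

lemma card_win_now_or_later:
  assumes "length \<sigma> \<in> {1..N}"
  shows "card {\<pi> \<in> Perms N. (entry \<pi> (length \<sigma>) = N \<or> wins d (length \<sigma>) i \<pi>) \<and> prefix_of \<sigma> \<pi>} =
    Win N \<sigma> + win_count N d i \<sigma>"
proof -
  have "\<not> wins d (length \<sigma>) i \<pi>" if \<pi>: "\<pi> \<in> Perms N" "entry \<pi> (length \<sigma>) = N" for \<pi>
  proof
    assume "wins d (length \<sigma>) i \<pi>"
    then obtain p where "p \<in> {length \<sigma><..N}" "entry \<pi> p = N"
      using Perms_length[OF \<pi>(1)] by (fastforce simp: wins_def accepts_def)
    then show False
      using entry_inject_Perms[OF \<pi>(1), of p "length \<sigma>"] \<pi>(2) assms by auto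
  qed
  then have "{\<pi> \<in> Perms N. prefix_of \<sigma> \<pi> \<and> entry \<pi> (length \<sigma>) = N} \<inter>
      {\<pi> \<in> Perms N. prefix_of \<sigma> \<pi> \<and> wins d (length \<sigma>) i \<pi>} = {}"
    by auto
  then have "Win N \<sigma> + win_count N d i \<sigma> = card ({\<pi> \<in> Perms N. prefix_of \<sigma> \<pi> \<and> entry \<pi> (length \<sigma>) = N} \<union>
      {\<pi> \<in> Perms N. prefix_of \<sigma> \<pi> \<and> wins d (length \<sigma>) i \<pi>})"
    unfolding Win_def win_count_def by (subst card_Un_disjoint) auto
  also have "\<dots> = card {\<pi> \<in> Perms N. (entry \<pi> (length \<sigma>) = N \<or> wins d (length \<sigma>) i \<pi>) \<and> prefix_of \<sigma> \<pi>}"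
    by (rule arg_cong[of _ _ card]) auto
  finally show ?thesis by simp
qed

section \<open>The prefix tree and its one-step recursion\<close>

definition children :: "nat \<Rightarrow> nat list \<Rightarrow> nat list set" where
  "children N \<sigma> = (\<lambda>\<pi>. restr \<pi> (Suc (length \<sigma>))) ` {\<pi> \<in> Perms N. prefix_of \<sigma> \<pi>}"

lemma length_children:
  assumes "length \<sigma> < N" "\<tau> \<in> children N \<sigma>"
  shows "length \<tau> = Suc (length \<sigma>)"
  using assms by (auto simp: children_def Perms_length)

lemma prefix_of_children:
  assumes "length \<sigma> < N" "\<tau> \<in> children N \<sigma>"
  shows "prefix_of \<sigma> \<tau>"
  using assms by (auto simp: children_def Perms_length prefix_of_def restr_restr)

lemma SD_pos_children:
  assumes "length \<sigma> < N" "\<tau> \<in> children N \<sigma>"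
  shows "SD N \<tau> > 0"
proof -
  obtain \<pi> where "\<pi> \<in> Perms N" "\<tau> = restr \<pi> (Suc (length \<sigma>))"
    using assms by (auto simp: children_def)
  then have "\<pi> \<in> {\<pi> \<in> Perms N. prefix_of \<tau> \<pi>}"
    using assms(1) by (simp add: prefix_of_restr Perms_length)
  then show ?thesis
    unfolding SD_def by (subst card_gt_0_iff) auto
qed

text \<open>Each \<open>\<sigma>\<close>-prefixed permutation passes through exactly one child
  \<open>\<tau>\<close>, and on all permutations through \<open>\<tau>\<close> the next decision is
  the same, \<open>d \<tau> i\<close>. This is the dynamic programming recursion for a fixed
  strategy.\<close>

lemma win_count_step:
  assumes "length \<sigma> < N"
  shows "win_count N d i \<sigma> = (\<Sum>\<tau>\<in>children N \<sigma>.
    if i > 0 \<and> d \<tau> i then Win N \<tau> + win_count N d (i - 1) \<tau> else win_count N d i \<tau>)"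
proof -
  define X where "X = {\<pi> \<in> Perms N. prefix_of \<sigma> \<pi> \<and> wins d (length \<sigma>) i \<pi>}"
  have "win_count N d i \<sigma> = (\<Sum>\<tau>\<in>children N \<sigma>. card {\<pi> \<in> X. prefix_of \<tau> \<pi>})"
    unfolding win_count_def X_def[symmetric]
  proof (rule sum_card_unique[symmetric])
    show "finite (children N \<sigma>)" "finite X"
      by (auto simp: children_def X_def)
    fix \<pi> assume "\<pi> \<in> X"
    then have \<pi>: "\<pi> \<in> Perms N" "prefix_of \<sigma> \<pi>"
      by (auto simp: X_def)
    show "\<exists>!\<tau>. \<tau> \<in> children N \<sigma> \<and> prefix_of \<tau> \<pi>"
    proof (rule ex1I)
      show "restr \<pi> (Suc (length \<sigma>)) \<in> children N \<sigma> \<and> prefix_of (restr \<pi> (Suc (length \<sigma>))) \<pi>"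
        using \<pi> assms by (auto simp: children_def prefix_of_restr Perms_length)
      show "\<tau> = restr \<pi> (Suc (length \<sigma>))" if "\<tau> \<in> children N \<sigma> \<and> prefix_of \<tau> \<pi>" for \<tau>
        using that length_children[OF assms] by (auto simp: prefix_of_def)
    qed
  qed
  also have "\<dots> = (\<Sum>\<tau>\<in>children N \<sigma>.
    if i > 0 \<and> d \<tau> i then Win N \<tau> + win_count N d (i - 1) \<tau> else win_count N d i \<tau>)"
  proof (rule sum.cong[OF refl])
    fix \<tau> assume \<tau>: "\<tau> \<in> children N \<sigma>"
    have len: "length \<tau> = Suc (length \<sigma>)"
      using assms \<tau> by (rule length_children)
    have "{\<pi> \<in> X. prefix_of \<tau> \<pi>} = {\<pi> \<in> Perms N. prefix_of \<tau> \<pi> \<and> wins d (length \<sigma>) i \<pi>}"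
      using prefix_of_trans[OF prefix_of_children[OF assms \<tau>]] by (auto simp: X_def)
    also have "\<dots> = {\<pi> \<in> Perms N. prefix_of \<tau> \<pi> \<and> (if i > 0 \<and> d \<tau> i
        then entry \<pi> (length \<tau>) = N \<or> wins d (length \<tau>) (i - 1) \<pi>
        else wins d (length \<tau>) i \<pi>)}"
    proof (intro Collect_cong conj_cong refl)
      fix \<pi> assume \<pi>: "\<pi> \<in> Perms N" "prefix_of \<tau> \<pi>"
      then have "restr \<pi> (Suc (length \<sigma>)) = \<tau>" "length \<pi> = N"
        by (simp_all add: prefix_of_def len Perms_length)
      then show "wins d (length \<sigma>) i \<pi> = (if i > 0 \<and> d \<tau> i
          then entry \<pi> (length \<tau>) = N \<or> wins d (length \<tau>) (i - 1) \<pi>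
          else wins d (length \<tau>) i \<pi>)"
        using wins_step[of "length \<sigma>" \<pi> d i] assms by (simp only: len)
    qed
    finally have "{\<pi> \<in> X. prefix_of \<tau> \<pi>} = \<dots>" .
    then show "card {\<pi> \<in> X. prefix_of \<tau> \<pi>} =
      (if i > 0 \<and> d \<tau> i then Win N \<tau> + win_count N d (i - 1) \<tau> else win_count N d i \<tau>)"
      using card_win_now_or_later[of \<tau> N d "i - 1"] assms
      by (simp add: len win_count_def conj_commute)
  qed
  finally show ?thesis .
qed

lemma Win_eq_0_if_not_eligible:
  assumes "length \<sigma> \<in> {1..N}" "\<not> eligible N \<sigma>"
  shows "Win N \<sigma> = 0"
proof -
  have "entry \<pi> (length \<sigma>) \<noteq> N" if "\<pi> \<in> Perms N" "prefix_of \<sigma> \<pi>" for \<pi>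
    using lr_max_restr_maximum[OF that(1) assms(1)] that assms
    by (auto simp: eligible_def prefix_of_def)
  then have "{\<pi> \<in> Perms N. prefix_of \<sigma> \<pi> \<and> entry \<pi> (length \<sigma>) = N} = {}"
    by auto
  then show ?thesis
    unfolding Win_def by (metis card.empty)
qed

section \<open>Probabilities as counts\<close>

lemma prob_interview_order:
  "\<P>(\<pi> in interview_order N. P \<pi>) = real (card {\<pi> \<in> Perms N. P \<pi>}) / fact N"
  by (simp add: interview_order_def measure_pmf_of_set Int_def)

lemma cond_prob_interview_order:
  "\<P>(\<pi> in interview_order N. P \<pi> \<bar> prefix_of \<sigma> \<pi>) =
    real (card {\<pi> \<in> Perms N. P \<pi> \<and> prefix_of \<sigma> \<pi>}) / real (SD N \<sigma>)"
  unfolding cond_prob_def prob_interview_order SD_def by simp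

text \<open>There are infinitely many strategies, but the bounded natural numerators leave only
  finitely many values, so \<open>Max\<close> is a genuine maximum.\<close>

lemma Max_range_divide:
  fixes f :: "'a \<Rightarrow> nat"
  assumes "\<And>x. f x \<le> f m"
  shows "Max (range (\<lambda>x. real (f x) / real c)) = real (f m) / real c"
proof (rule Max_eqI)
  have "range (\<lambda>x. real (f x) / real c) \<subseteq> (\<lambda>n. real n / real c) ` {..f m}"
    using assms by auto
  then show "finite (range (\<lambda>x. real (f x) / real c))"
    by (rule finite_subset) auto
qed (use assms in \<open>auto intro!: divide_right_mono\<close>)

lemma Qo_eq:
  assumes "\<And>d. win_count N d i \<sigma> \<le> win_count N m i \<sigma>"
  shows "Qo N i \<sigma> = real (win_count N m i \<sigma>) / real (SD N \<sigma>)"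
proof -
  have "card {\<pi> \<in> Perms N. wins d (length \<sigma>) i \<pi> \<and> prefix_of \<sigma> \<pi>} = win_count N d i \<sigma>" for d
    by (simp add: win_count_def conj_commute)
  then show ?thesis
    unfolding Qo_def cond_prob_interview_order using Max_range_divide[of "\<lambda>d. win_count N d i \<sigma>" m] assms
    by simp
qed

lemma Q_eq:
  assumes "length \<sigma> \<in> {1..N}" "i > 0" "\<And>d. win_count N d (i - 1) \<sigma> \<le> win_count N m (i - 1) \<sigma>"
  shows "Q N i \<sigma> = real (Win N \<sigma> + win_count N m (i - 1) \<sigma>) / real (SD N \<sigma>)"
\<comment> \<open>\<open>Q\<close> treats \<open>i = 1\<close> separately. The formula still covers
  it, since nothing is won later with 0 selections.\<close>
proof (cases "i = 1")
  case True
  then show ?thesis by (simp add: Q_def)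
next
  case False
  then show ?thesis
    unfolding Q_def cond_prob_interview_order card_win_now_or_later[OF assms(1)]
    using Max_range_divide[of "\<lambda>d. Win N \<sigma> + win_count N d (i - 1) \<sigma>" m] assms(3)
    by simp
qed

section \<open>The optimal strategy\<close>

text \<open>Not circular: \<open>type_positive\<close> compares maxima over all strategies. That
  \<open>greedy\<close> itself attains these maxima is shown afterwards. Ties are resolved by
  accepting.\<close>

definition greedy :: "nat \<Rightarrow> strategy" where
  "greedy N \<sigma> i \<longleftrightarrow> eligible N \<sigma> \<and> type_positive N i \<sigma>"

text \<open>At an eligible prefix, positivity is exactly the comparison of the two counts, over the
  common denominator \<open>SD N \<tau>\<close>. Otherwise \<open>Win N \<tau>\<close> is 0, and
  holding a selection back shows that rejecting is at least as good.\<close>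

lemma greedy_optimal_choice:
  assumes len: "length \<tau> \<in> {1..N}" and SD: "SD N \<tau> > 0" and i: "i > 0"
    and opt: "\<And>d j. win_count N d j \<tau> \<le> win_count N (greedy N) j \<tau>"
  shows "max (Win N \<tau> + win_count N (greedy N) (i - 1) \<tau>) (win_count N (greedy N) i \<tau>) =
    (if greedy N \<tau> i then Win N \<tau> + win_count N (greedy N) (i - 1) \<tau> else win_count N (greedy N) i \<tau>)"
proof (cases "eligible N \<tau>")
  case True
  have "type_positive N i \<tau> \<longleftrightarrow>
      win_count N (greedy N) i \<tau> \<le> Win N \<tau> + win_count N (greedy N) (i - 1) \<tau>"
    unfolding type_positive_def Q_eq[OF len i opt] Qo_eq[OF opt]
    using SD by (simp add: divide_le_cancel flip: of_nat_add)
  with True show ?thesis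
    by (auto simp: greedy_def)
next
  case False
  have "win_count N (greedy N) (i - 1) \<tau> \<le> win_count N (greedy N) i \<tau>"
    using win_count_spare[of N "greedy N" "i - 1" \<tau>] opt[of _ i] i
    by (auto intro: le_trans)
  with False show ?thesis
    by (simp add: greedy_def Win_eq_0_if_not_eligible[OF len])
qed

text \<open>Backward induction from length \<open>N\<close>, where nothing can be won any more. In
  the one-step recursion each child contributes to \<open>d\<close> at most the maximum of accepting
  and rejecting with optimal continuation, and \<open>greedy\<close> attains that maximum.\<close>

lemma greedy_optimal:
  "length \<sigma> \<le> N \<Longrightarrow> win_count N d i \<sigma> \<le> win_count N (greedy N) i \<sigma>"
proof (induction "N - length \<sigma>" arbitrary: \<sigma> d i)
  case 0
  then show ?case
    by (simp add: win_count_def Perms_length not_wins_at_end cong: conj_cong)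
next
  case (Suc n)
  then have \<sigma>: "length \<sigma> < N" by simp
  show ?case
    unfolding win_count_step[OF \<sigma>]
  proof (rule sum_mono)
    fix \<tau> assume \<tau>: "\<tau> \<in> children N \<sigma>"
    have len: "length \<tau> = Suc (length \<sigma>)"
      using \<sigma> \<tau> by (rule length_children)
    have opt: "win_count N d j \<tau> \<le> win_count N (greedy N) j \<tau>" for d j
      using Suc len \<sigma> by simp
    show "(if i > 0 \<and> d \<tau> i then Win N \<tau> + win_count N d (i - 1) \<tau> else win_count N d i \<tau>) \<le>
      (if i > 0 \<and> greedy N \<tau> i then Win N \<tau> + win_count N (greedy N) (i - 1) \<tau>
       else win_count N (greedy N) i \<tau>)"
    proof (cases "i > 0")
      case True
      have "(if d \<tau> i then Win N \<tau> + win_count N d (i - 1) \<tau> else win_count N d i \<tau>) \<le>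
        max (Win N \<tau> + win_count N (greedy N) (i - 1) \<tau>) (win_count N (greedy N) i \<tau>)"
        using opt[of d i] opt[of d "i - 1"] by auto
      then show ?thesis
        using greedy_optimal_choice[OF _ SD_pos_children[OF \<sigma> \<tau>] True opt] len \<sigma> True by simp
    qed simp
  qed
qed

text \<open>No applicant remains after the last one, so \<open>Qo\<close> is 0 and accepting cannot
  be worse.\<close>

lemma greedy_full_length:
  assumes "\<pi> \<in> Perms N" "N \<ge> 1" "i > 0"
  shows "greedy N \<pi> i"
proof -
  have len: "length \<pi> = N"
    using assms by (simp add: Perms_length)
  have "win_count N d i \<pi> = 0" for d
    using len by (simp add: win_count_def Perms_length not_wins_at_end cong: conj_cong)
  then have "Qo N i \<pi> = 0"
    using Qo_eq[of N i \<pi> "greedy N"] by simp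
  moreover have "Q N i \<pi> \<ge> 0"
    using Q_eq[of \<pi> N i "greedy N"] greedy_optimal[of \<pi> N] len assms by simp
  ultimately show ?thesis
    using len by (simp add: greedy_def eligible_def type_positive_def)
qed

lemma max_win_prob_eq:
  "max_win_prob N s = real (card {\<pi> \<in> Perms N. wins (greedy N) 0 s \<pi>}) / fact N"
proof -
  \<comment> \<open>The empty list is a prefix of everything, so the whole game is the root of the
    prefix tree.\<close>
  have "card {\<pi> \<in> Perms N. wins d 0 s \<pi>} = win_count N d s []" for d
    by (simp add: win_count_def prefix_of_def restr_def relabel_def)
  then show ?thesis
    unfolding max_win_prob_def prob_interview_order
    using Max_range_divide[of "\<lambda>d. win_count N d s []" "greedy N" "fact N"] greedy_optimal[of "[]" N]
    by simp
qed

section \<open>The strike set\<close>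

definition selected_level :: "nat \<Rightarrow> strategy \<Rightarrow> nat \<Rightarrow> nat \<Rightarrow> nat list set" where
  "selected_level N d s i = {\<sigma> \<in> selected N d s. selection_index d s \<sigma> = i}"

text \<open>The position where the number of selections first drops below \<open>s\<close> is an
  acceptance made with all \<open>s\<close> available.\<close>

lemma first_acceptance:
  "sels_left d 0 s \<pi> p < s \<Longrightarrow> p \<le> length \<pi> \<Longrightarrow>
    \<exists>q. accepts d 0 s \<pi> q \<and> sels_left d 0 s \<pi> (q - 1) = s"
proof (induction p)
  case (Suc p)
  show ?case
  proof (cases "sels_left d 0 s \<pi> p < s")
    case True
    with Suc show ?thesis by simp
  next
    case False
    then have "sels_left d 0 s \<pi> p = s"
      using sels_left_antimono[of 0 p d 0 s \<pi>] by simp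
    with Suc.prems show ?thesis
      by (intro exI[of _ "Suc p"]) (auto simp: accepts_def split: if_splits)
  qed
qed simp

text \<open>Existence: either a selection is made before the last applicant, or all \<open>s\<close>
  remain and \<open>greedy\<close> accepts that applicant. Uniqueness: two prefixes of
  \<open>\<pi>\<close> are nested, and nested selected prefixes have different indices.\<close>

lemma ex1_prefix_in_top_level:
  assumes "N \<ge> 1" "s \<ge> 1" and \<pi>: "\<pi> \<in> Perms N"
  shows "\<exists>!\<sigma>. \<sigma> \<in> selected_level N (greedy N) s s \<and> prefix_of \<sigma> \<pi>"
proof -
  have len: "length \<pi> = N"
    using \<pi> by (rule Perms_length)
  have "\<exists>q. accepts (greedy N) 0 s \<pi> q \<and> sels_left (greedy N) 0 s \<pi> (q - 1) = s"
  proof (cases "sels_left (greedy N) 0 s \<pi> (N - 1) < s")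
    case True
    then show ?thesis
      using first_acceptance len by simp
  next
    case False
    then have "sels_left (greedy N) 0 s \<pi> (N - 1) = s"
      using sels_left_antimono[of 0 "N - 1" "greedy N" 0 s \<pi>] by simp
    then show ?thesis
      using assms len greedy_full_length[OF \<pi>, of s]
      by (intro exI[of _ N]) (simp add: accepts_def restr_Perms_self)
  qed
  then obtain q where q: "accepts (greedy N) 0 s \<pi> q" "sels_left (greedy N) 0 s \<pi> (q - 1) = s"
    by blast
  then have "q \<le> N"
    by (simp add: accepts_def len)
  then have pre: "prefix_of (restr \<pi> q) \<pi>" and "length (restr \<pi> q) = q"
    by (simp_all add: prefix_of_restr len)
  then have "selection_index (greedy N) s (restr \<pi> q) = s"
    using sels_left_eq_selection_index[OF pre, of "greedy N" s] q by simp
  moreover have "restr \<pi> q \<in> selected N (greedy N) s"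
    using q \<pi> by (auto simp: selected_def)
  ultimately have ex: "restr \<pi> q \<in> selected_level N (greedy N) s s"
    by (simp add: selected_level_def)
  have le: "length \<sigma> \<ge> length \<tau>"
    if "\<sigma> \<in> selected_level N (greedy N) s s" "prefix_of \<sigma> \<pi>"
      "\<tau> \<in> selected_level N (greedy N) s s" "prefix_of \<tau> \<pi>" for \<sigma> \<tau>
  proof (rule ccontr)
    assume "\<not> length \<sigma> \<ge> length \<tau>"
    then have "proper_prefix_of \<sigma> \<tau>"
      using that(2,4) restr_restr[of "length \<sigma>" "length \<tau>" \<pi>]
      by (auto simp: proper_prefix_of_def prefix_of_def)
    then show False
      using selection_index_proper_prefix[of \<sigma> N "greedy N" s \<tau>] that(1,3)
      by (simp add: selected_level_def)
  qed
  show ?thesis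
  proof (rule ex1I)
    show "restr \<pi> q \<in> selected_level N (greedy N) s s \<and> prefix_of (restr \<pi> q) \<pi>"
      using ex pre by simp
    fix \<sigma> assume \<sigma>: "\<sigma> \<in> selected_level N (greedy N) s s \<and> prefix_of \<sigma> \<pi>"
    then have "length \<sigma> = length (restr \<pi> q)"
      using le[of \<sigma> "restr \<pi> q"] le[of "restr \<pi> q" \<sigma>] ex pre by (simp add: le_antisym)
    then show "\<sigma> = restr \<pi> q"
      using \<sigma> pre by (metis prefix_of_def)
  qed
qed

text \<open>An acceptance with all \<open>s\<close> selections available is the first one, so no win
  can occur before the end of \<open>\<sigma>\<close>, and \<open>s - 1\<close> selections remain
  after it.\<close>

lemma wins_from_top_level:
  assumes "\<sigma> \<in> selected_level N d s s" and \<pi>: "\<pi> \<in> Perms N" "prefix_of \<sigma> \<pi>"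
  shows "wins d 0 s \<pi> \<longleftrightarrow> entry \<pi> (length \<sigma>) = N \<or> wins d (length \<sigma>) (s - 1) \<pi>"
proof -
  have acc: "accepts d 0 s \<pi> (length \<sigma>)"
    using assms accepts_of_selected by (auto simp: selected_level_def)
  have idx: "sels_left d 0 s \<pi> (length \<sigma> - 1) = s"
    using assms(1) sels_left_eq_selection_index[OF \<pi>(2), of d s] by (simp add: selected_level_def)
  have "p = length \<sigma>" if "accepts d 0 s \<pi> p" "p \<in> {0<..length \<sigma>}" for p
  proof (rule ccontr)
    assume "p \<noteq> length \<sigma>"
    then have "s \<le> sels_left d 0 s \<pi> p"
      using sels_left_antimono[of p "length \<sigma> - 1" d 0 s \<pi>] that(2) idx by force
    then show False
      using sels_left_accepts[OF that(1)] sels_left_antimono[of 0 "p - 1" d 0 s \<pi>] by simp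
  qed
  moreover have "length \<sigma> \<in> {0<..length \<sigma>}"
    using acc by (auto simp: accepts_def)
  ultimately have "(\<exists>p\<in>{0<..length \<sigma>}. accepts d 0 s \<pi> p \<and> entry \<pi> p = length \<pi>) \<longleftrightarrow>
      entry \<pi> (length \<sigma>) = N"
    using acc Perms_length[OF \<pi>(1)] by metis
  moreover have "sels_left d 0 s \<pi> (length \<sigma>) = s - 1"
    using sels_left_accepts[OF acc] idx by simp
  ultimately show ?thesis
    using wins_split[of 0 "length \<sigma>" d s \<pi>] by simp
qed

lemma SD_pos_selected:
  assumes "\<sigma> \<in> selected N d s"
  shows "SD N \<sigma> > 0"
proof -
  obtain \<pi> where "\<pi> \<in> Perms N" "prefix_of \<sigma> \<pi>"
    using assms by (rule selectedE)
  then have "{\<pi> \<in> Perms N. prefix_of \<sigma> \<pi>} \<noteq> {}"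
    by blast
  then show ?thesis
    by (simp add: SD_def card_gt_0_iff)
qed

lemma sum_SD_top_level:
  assumes "N \<ge> 1" "s \<ge> 1"
  shows "(\<Sum>\<sigma>\<in>selected_level N (greedy N) s s. SD N \<sigma>) = fact N"
  unfolding SD_def card_Perms[symmetric]
  using ex1_prefix_in_top_level[OF assms] by (intro sum_card_unique) (simp_all add: selected_level_def)

text \<open>Continuing with \<open>greedy\<close> after the first selection attains
  \<open>Q N s \<sigma>\<close>, so each summand counts the \<open>\<sigma>\<close>-prefixed
  permutations on which \<open>greedy\<close> wins.\<close>

lemma sum_Q_top_level:
  assumes "N \<ge> 1" "s \<ge> 1"
  shows "(\<Sum>\<sigma>\<in>selected_level N (greedy N) s s. Q N s \<sigma> * real (SD N \<sigma>)) =
    real (card {\<pi> \<in> Perms N. wins (greedy N) 0 s \<pi>})"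
proof -
  let ?L = "selected_level N (greedy N) s s" and ?X = "{\<pi> \<in> Perms N. wins (greedy N) 0 s \<pi>}"
  have "Q N s \<sigma> * real (SD N \<sigma>) = real (card {\<pi> \<in> ?X. prefix_of \<sigma> \<pi>})" if \<sigma>: "\<sigma> \<in> ?L" for \<sigma>
  proof -
    have sel: "\<sigma> \<in> selected N (greedy N) s"
      using \<sigma> by (simp add: selected_level_def)
    then have len: "length \<sigma> \<in> {1..N}"
      by (rule selected_decision)
    have "{\<pi> \<in> ?X. prefix_of \<sigma> \<pi>} = {\<pi> \<in> Perms N. (entry \<pi> (length \<sigma>) = N \<or>
        wins (greedy N) (length \<sigma>) (s - 1) \<pi>) \<and> prefix_of \<sigma> \<pi>}"
      using wins_from_top_level[OF \<sigma>] by auto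
    then have "card {\<pi> \<in> ?X. prefix_of \<sigma> \<pi>} = Win N \<sigma> + win_count N (greedy N) (s - 1) \<sigma>"
      using card_win_now_or_later[OF len] by simp
    moreover have "Q N s \<sigma> = real (Win N \<sigma> + win_count N (greedy N) (s - 1) \<sigma>) / real (SD N \<sigma>)"
      using len assms greedy_optimal by (intro Q_eq) auto
    ultimately show ?thesis
      using SD_pos_selected[OF sel] by simp
  qed
  then have "(\<Sum>\<sigma>\<in>?L. Q N s \<sigma> * real (SD N \<sigma>)) = real (\<Sum>\<sigma>\<in>?L. card {\<pi> \<in> ?X. prefix_of \<sigma> \<pi>})"
    by simp
  also have "(\<Sum>\<sigma>\<in>?L. card {\<pi> \<in> ?X. prefix_of \<sigma> \<pi>}) = card ?X"
    using ex1_prefix_in_top_level[OF assms]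
    by (intro sum_card_unique) (simp_all add: selected_level_def)
  finally show ?thesis .
qed

text \<open>Each winning permutation is counted once, at the selected prefix that ends where the
  value \<open>N\<close> stands.\<close>

lemma sum_Win_selected:
  "(\<Sum>\<sigma>\<in>selected N d s. Win N \<sigma>) = card {\<pi> \<in> Perms N. wins d 0 s \<pi>}"
proof -
  let ?X = "{\<pi> \<in> Perms N. wins d 0 s \<pi>}"
  let ?R = "\<lambda>\<sigma> \<pi>. prefix_of \<sigma> \<pi> \<and> entry \<pi> (length \<sigma>) = N"
  have "Win N \<sigma> = card {\<pi> \<in> ?X. ?R \<sigma> \<pi>}" if "\<sigma> \<in> selected N d s" for \<sigma>
  proof -
    have "wins d 0 s \<pi>" if "\<pi> \<in> Perms N" "?R \<sigma> \<pi>" for \<pi>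
      using accepts_of_selected[OF \<open>\<sigma> \<in> selected N d s\<close> that(1)] that
      unfolding wins_def by (metis Perms_length)
    then show ?thesis
      unfolding Win_def by (intro arg_cong[of _ _ card]) auto
  qed
  then have "(\<Sum>\<sigma>\<in>selected N d s. Win N \<sigma>) = (\<Sum>\<sigma>\<in>selected N d s. card {\<pi> \<in> ?X. ?R \<sigma> \<pi>})"
    by (rule sum.cong[OF refl])
  also have "\<dots> = card ?X"
  proof (rule sum_card_unique)
    fix \<pi> assume "\<pi> \<in> ?X"
    then obtain p where p: "\<pi> \<in> Perms N" "accepts d 0 s \<pi> p" "entry \<pi> p = N"
      by (auto simp: wins_def Perms_length)
    then have "p \<in> {1..N}"
      by (auto simp: accepts_def Perms_length)
    show "\<exists>!\<sigma>. \<sigma> \<in> selected N d s \<and> ?R \<sigma> \<pi>"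
    proof (rule ex1I)
      show "restr \<pi> p \<in> selected N d s \<and> ?R (restr \<pi> p) \<pi>"
        using p \<open>p \<in> {1..N}\<close> by (auto simp: selected_def prefix_of_restr Perms_length)
      \<comment> \<open>The unique position of \<open>N\<close> fixes the length of
        \<open>\<sigma>\<close>, and the length fixes the prefix.\<close>
      show "\<sigma> = restr \<pi> p" if "\<sigma> \<in> selected N d s \<and> ?R \<sigma> \<pi>" for \<sigma>
        using that entry_inject_Perms[OF p(1) selected_decision(3) \<open>p \<in> {1..N}\<close>, of \<sigma> d s] p(3)
        by (auto simp: prefix_of_def)
    qed
  qed auto
  finally show ?thesis .
qed

theorem mainTheorem4:
  fixes N s :: nat
  assumes "N \<ge> 1" and "s \<ge> 1"
  shows "\<exists>(A :: nat list set) (B :: nat \<Rightarrow> nat list set).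
    strike_set N s A \<and>
    A = (\<Union>i\<in>{1..s}. B i) \<and>
    disjoint_family_on B {1..s} \<and>
    (\<forall>i\<in>{1..s}. minimal 1 (B i) \<and> (\<forall>\<sigma>\<in>B i. type_positive N i \<sigma>)) \<and>
    max_win_prob N s = frac_value (\<Sum>\<sigma>\<in>B s. unreduced N \<sigma> (Q N s \<sigma>)) \<and>
    max_win_prob N s = (\<Sum>\<sigma>\<in>A. Q N 1 \<sigma> * real (SD N \<sigma>)) / fact N"
proof (intro exI conjI)
  let ?A = "selected N (greedy N) s" and ?B = "selected_level N (greedy N) s"
  have greedy: "greedy N \<sigma> (selection_index (greedy N) s \<sigma>)" if "\<sigma> \<in> ?A" for \<sigma>
    using that by (rule selected_decision)
  show "strike_set N s ?A"
    unfolding strike_set_def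
  proof (intro conjI ballI)
    show "?A \<subseteq> (\<Union>j\<in>{1..N}. Perms j)"
      using selected_decision(3,4) by fast
    show "eligible N \<sigma>" if "\<sigma> \<in> ?A" for \<sigma>
      using greedy[OF that] by (simp add: greedy_def)
    show "minimal s ?A"
      by (rule minimal_selected)
    show "\<exists>\<sigma>\<in>?A. prefix_of \<sigma> \<pi>" if "\<pi> \<in> Perms N" for \<pi>
      using ex1_prefix_in_top_level[OF assms that] by (auto simp: selected_level_def)
  qed
  show "?A = (\<Union>i\<in>{1..s}. ?B i)"
    using selected_decision(2) by (fastforce simp: selected_level_def)
  show "disjoint_family_on ?B {1..s}"
    by (auto simp: disjoint_family_on_def selected_level_def)
  show "\<forall>i\<in>{1..s}. minimal 1 (?B i) \<and> (\<forall>\<sigma>\<in>?B i. type_positive N i \<sigma>)"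
    using greedy minimal_selected_level by (auto simp: selected_level_def greedy_def)
  \<comment> \<open>The denominators of the unreduced fractions add up to \<open>fact N\<close>, so
    only the numerators remain to be compared.\<close>
  have "(\<Sum>\<sigma>\<in>?B s. real (SD N \<sigma>)) = fact N"
    using arg_cong[OF sum_SD_top_level[OF assms], of real] by simp
  then show "max_win_prob N s = frac_value (\<Sum>\<sigma>\<in>?B s. unreduced N \<sigma> (Q N s \<sigma>))"
    by (simp add: max_win_prob_eq frac_value_def unreduced_def fst_sum snd_sum sum_Q_top_level[OF assms])
  have "(\<Sum>\<sigma>\<in>?A. Q N 1 \<sigma> * real (SD N \<sigma>)) = (\<Sum>\<sigma>\<in>?A. real (Win N \<sigma>))"
    using SD_pos_selected by (intro sum.cong) (auto simp: Q_def)
  also have "\<dots> = real (card {\<pi> \<in> Perms N. wins (greedy N) 0 s \<pi>})"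
    by (simp flip: sum_Win_selected)
  finally show "max_win_prob N s = (\<Sum>\<sigma>\<in>?A. Q N 1 \<sigma> * real (SD N \<sigma>)) / fact N"
    by (simp add: max_win_prob_eq)
qed

end
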